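(* Let $\big(g_k\colon\mathbb{R}^d\to\mathbb{R}^d\big)_{k\ge0}$ be a non-autonomous dynamical system such that each map $g_k$ has the Luzin $N^{-1}$ property. Then the system avoids its set of NPH (non-uniformly pseudo-hyperbolic) unstable fixed points.
   Context: A (discrete-time) non-autonomous dynamical system on $\mathbb{R}^d$ is a sequence of maps $(g_k\colon\mathbb{R}^d\to\mathbb{R}^d)_{k\ge0}$; the trajectory from $x_0$ is given by $x_{k+1}=g_k(x_k)$, $k\ge0$. The system avoids a set $S$ of fixed points if the set of initial points $x_0\in\mathbb{R}^d$ whose trajectory converges to some point of $S$ has Lebesgue measure zero. Luzin $N^{-1}$: a map $g\colon\mathbb{R}^d\to\mathbb{R}^d$ has the Luzin $N^{-1}$ property if for every $E\subseteq\mathbb{R}^d$ of Lebesgue measure zero, $g^{-1}(E)$ has Lebesgue measure zero. Conventions. $\mathbb{R}^d=E_{\mathrm{cs}}\oplus E_{\mathrm{u}}$ means that $E_{\mathrm{cs}},E_{\mathrm{u}}$ are linear subspaces and each $x\in\mathbb{R}^d$ is uniquely $x=y+z$ with $y\in E_{\mathrm{cs}}$, $z\in E_{\mathrm{u}}$. Given norms on $E_{\mathrm{cs}}$ and $E_{\mathrm{u}}$, the space $\mathbb{R}^d$ is equipped with the max-norm $\|x\|=\max(\|y\|_{E_{\mathrm{cs}}},\|z\|_{E_{\mathrm{u}}})$; $B_r(0)$ is the corresponding open ball. For a map $h$ and a set $U$, $\mathrm{Lip}(h|_U)=\sup_{x\ne y\in U}\|h(x)-h(y)\|/\|x-y\|\in[0,\infty]$.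 Pseudo-hyperbolicity. Let $g\colon\mathbb{R}^d\to\mathbb{R}^d$ be a map, $T\colon\mathbb{R}^d\to\mathbb{R}^d$ linear, and $\mu,\lambda,\varepsilon\in\mathbb{R}$ with $1\le\lambda<\mu$, $\varepsilon>0$. Let $U$ be an open neighborhood of $0$. We write $(g,T)\in\mathrm{PH}(\mu,\lambda,\varepsilon;U,E_{\mathrm{cs}}\oplus E_{\mathrm{u}})$ (with respect to specified norms on $E_{\mathrm{cs}},E_{\mathrm{u}}$) if: (1) $g(0)=0$; (2) $T(E_{\mathrm{cs}})\subseteq E_{\mathrm{cs}}$ and $T(E_{\mathrm{u}})\subseteq E_{\mathrm{u}}$; (3) $\|Ty\|\le\lambda\|y\|$ for all $y\in E_{\mathrm{cs}}$ and $\|Tz\|\ge\mu\|z\|$ for all $z\in E_{\mathrm{u}}$; (4) $\mathrm{Lip}((g-T)|_U)\le\varepsilon<(\mu-\lambda)/4$ with respect to the max-norm. NPH unstable fixed point. For $x^\ast\in\mathbb{R}^d$ let $(g_k-x^\ast)$ denote the shifted map $x\mapsto g_k(x+x^\ast)-x^\ast$. A point $x^\ast$ is an NPH unstable fixed point of $(g_k)_{k\ge0}$ if $g_k(x^\ast)=x^\ast$ for all $k\ge 0$ and there exist a splitting $\mathbb{R}^d=E_{\mathrm{cs}}\oplus E_{\mathrm{u}}$ with $\dim E_{\mathrm{u}}\ge1$, norms on $E_{\mathrm{cs}}$ and $E_{\mathrm{u}}$, linear maps $(T_k\colon\mathbb{R}^d\to\mathbb{R}^d)_{k\ge0}$, a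 radius $r>0$, an index $K\ge0$ and positive constants $(\mu_k,\lambda_k,\varepsilon_k)_{k\ge K}$ such that: (a) $(g_k-x^\ast,T_k)\in\mathrm{PH}(\mu_k,\lambda_k,\varepsilon_k/4;B_r(0),E_{\mathrm{cs}}\oplus E_{\mathrm{u}})$ with respect to these same norms for all $k\ge K$; (b) $\varepsilon_k<(\mu_k-\lambda_k)/4$ for all $k\ge K$; (c) $\sum_{k=K}^\infty \varepsilon_k/(\mu_k-2\varepsilon_k)=+\infty$. *)

theory Defs
  imports "HOL-Analysis.Analysis"
begin

primrec trajectory :: "(nat \<Rightarrow> 'a \<Rightarrow> 'a) \<Rightarrow> 'a \<Rightarrow> nat \<Rightarrow> 'a" where
  "trajectory g x0 0 = x0"
| "trajectory g x0 (Suc k) = g k (trajectory g x0 k)"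

(* No measurability of the set of initial points is presupposed: lebesgue is complete, so
   its null sets are exactly the sets of Lebesgue outer measure zero. *)
definition avoids :: "(nat \<Rightarrow> 'a::euclidean_space \<Rightarrow> 'a) \<Rightarrow> 'a set \<Rightarrow> bool" where
  "avoids g S \<longleftrightarrow> {x0. \<exists>s\<in>S. trajectory g x0 \<longlonglongrightarrow> s} \<in> null_sets lebesgue"

definition luzin_N_inv :: "('a::euclidean_space \<Rightarrow> 'a) \<Rightarrow> bool" where
  "luzin_N_inv g \<longleftrightarrow> (\<forall>E. E \<in> null_sets lebesgue \<longrightarrow> g -` E \<in> null_sets lebesgue)"

definition splitting :: "'a::real_vector set \<Rightarrow> 'a set \<Rightarrow> bool" where
  "splitting Ecs Eu \<longleftrightarrow> subspace Ecs \<and> subspace Eu \<and>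
     (\<forall>x. \<exists>!p. fst p \<in> Ecs \<and> snd p \<in> Eu \<and> x = fst p + snd p)"

(* The component in E of x with respect to a splitting of the space into E and F;
   the component in F is component F E x. *)
definition component :: "'a::real_vector set \<Rightarrow> 'a set \<Rightarrow> 'a \<Rightarrow> 'a" where
  "component E F x = (THE y. y \<in> E \<and> x - y \<in> F)"

(* The values of N outside E are irrelevant. *)
definition norm_on :: "'a::real_vector set \<Rightarrow> ('a \<Rightarrow> real) \<Rightarrow> bool" where
  "norm_on E N \<longleftrightarrow>
     (\<forall>x\<in>E. 0 \<le> N x) \<and>
     (\<forall>x\<in>E. N x = 0 \<longleftrightarrow> x = 0) \<and>
     (\<forall>x\<in>E. \<forall>c. N (c *\<^sub>R x) = \<bar>c\<bar> * N x) \<and>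
     (\<forall>x\<in>E. \<forall>y\<in>E. N (x + y) \<le> N x + N y)"

definition max_norm ::
  "'a::real_vector set \<Rightarrow> 'a set \<Rightarrow> ('a \<Rightarrow> real) \<Rightarrow> ('a \<Rightarrow> real) \<Rightarrow> 'a \<Rightarrow> real" where
  "max_norm Ecs Eu Ncs Nu x = max (Ncs (component Ecs Eu x)) (Nu (component Eu Ecs x))"

definition Lip :: "('a::real_vector \<Rightarrow> real) \<Rightarrow> ('a \<Rightarrow> 'a) \<Rightarrow> 'a set \<Rightarrow> ennreal" where
  "Lip N h U = (SUP (x, y) \<in> {(x, y). x \<in> U \<and> y \<in> U \<and> x \<noteq> y}. ennreal (N (h x - h y) / N (x - y)))"

(* "open" refers to the standard topology, which every norm on a finite-dimensional
   space induces. *)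
definition PH ::
  "real \<Rightarrow> real \<Rightarrow> real \<Rightarrow> 'a::euclidean_space set \<Rightarrow> 'a set \<Rightarrow> 'a set \<Rightarrow>
   ('a \<Rightarrow> real) \<Rightarrow> ('a \<Rightarrow> real) \<Rightarrow> ('a \<Rightarrow> 'a) \<Rightarrow> ('a \<Rightarrow> 'a) \<Rightarrow> bool" where
  "PH \<mu> l \<epsilon> U Ecs Eu Ncs Nu g T \<longleftrightarrow>
     splitting Ecs Eu \<and> norm_on Ecs Ncs \<and> norm_on Eu Nu \<and>
     linear T \<and> 1 \<le> l \<and> l < \<mu> \<and> 0 < \<epsilon> \<and> open U \<and> 0 \<in> U \<and>
     g 0 = 0 \<and>
     T ` Ecs \<subseteq> Ecs \<and> T ` Eu \<subseteq> Eu \<and>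
     (\<forall>y\<in>Ecs. max_norm Ecs Eu Ncs Nu (T y) \<le> l * max_norm Ecs Eu Ncs Nu y) \<and>
     (\<forall>z\<in>Eu. max_norm Ecs Eu Ncs Nu (T z) \<ge> \<mu> * max_norm Ecs Eu Ncs Nu z) \<and>
     Lip (max_norm Ecs Eu Ncs Nu) (\<lambda>x. g x - T x) U \<le> ennreal \<epsilon> \<and> \<epsilon> < (\<mu> - l) / 4"

(* The sum in the last condition has positive terms, so its being infinite is divergence of
   the partial sums to infinity. *)
definition NPH_unstable_fixed_point ::
  "(nat \<Rightarrow> 'a::euclidean_space \<Rightarrow> 'a) \<Rightarrow> 'a \<Rightarrow> bool" where
  "NPH_unstable_fixed_point g xs \<longleftrightarrow>
     (\<forall>k. g k xs = xs) \<and>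
     (\<exists>Ecs Eu Ncs Nu T r K \<mu> l \<epsilon>.
        splitting Ecs Eu \<and> dim Eu \<ge> 1 \<and> norm_on Ecs Ncs \<and> norm_on Eu Nu \<and>
        (\<forall>k. linear (T k)) \<and> r > 0 \<and>
        (\<forall>k\<ge>K. \<mu> k > 0 \<and> l k > 0 \<and> \<epsilon> k > 0) \<and>
        (\<forall>k\<ge>K. PH (\<mu> k) (l k) (\<epsilon> k / 4) {x. max_norm Ecs Eu Ncs Nu x < r} Ecs Eu Ncs Nu
                  (\<lambda>x. g k (x + xs) - xs) (T k)) \<and>
        (\<forall>k\<ge>K. \<epsilon> k < (\<mu> k - l k) / 4) \<and>
        filterlim (\<lambda>n. \<Sum>k=K..n. \<epsilon> k / (\<mu> k - 2 * \<epsilon> k)) at_top sequentially)"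

end

theory Submission
  imports Defs
begin

text \<open>
  Near an unstable fixed point, compare two orbits whose difference lies in the cone where the
  unstable component has the larger norm. One step keeps the difference in this cone
  (\<open>PH_cone_step\<close>) and multiplies the norm of its unstable component by at least
  \<open>\<mu> - \<epsilon> / 4\<close>, which exceeds \<open>1 + 3 * \<epsilon>\<close> because \<open>\<mu> > l + 4 * \<epsilon>\<close> and
  \<open>l \<ge> 1\<close>. As \<open>\<mu> - 2 * \<epsilon> \<ge> 1\<close>, divergence of
  \<open>\<Sum> \<epsilon> / (\<mu> - 2 * \<epsilon>)\<close> forces divergence of \<open>\<Sum> \<epsilon>\<close>, so the two orbits cannot
  both stay in a bounded set. Hence the differences of any two points whose orbits stay close to
  the fixed point from a given time on avoid the cone, and those points form
  a subset of a Lipschitz graph over the center-stable space. Such a set, when bounded, is null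
  because its closure has infinitely many disjoint translates along one unstable direction, all
  inside one bounded set (\<open>null_of_cone_bound\<close>).

  Thus every unstable fixed point has an open neighborhood in which, from each sufficiently late
  time on, only a null set of points can remain (\<open>NPH_null_neighborhood\<close>). There may be
  uncountably many such fixed points, but by the Lindelof property countably many of these
  neighborhoods cover them all. A trajectory that converges to an unstable fixed point eventually
  stays in one of these neighborhoods, so at some finite time it lies in one of countably many
  null sets, and the Luzin property pulls these null sets back to time zero.
\<close>

section \<open>Seminorms induced by a splitting\<close>

definition seminorm :: "('a::real_vector \<Rightarrow> real) \<Rightarrow> bool" where
  "seminorm p \<longleftrightarrow> (\<forall>x y. p (x + y) \<le> p x + p y) \<and> (\<forall>c x. p (c *\<^sub>R x) = \<bar>c\<bar> * p x)"

lemma seminorm_add: "seminorm p \<Longrightarrow> p (x + y) \<le> p x + p y"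
  and seminorm_scaleR: "seminorm p \<Longrightarrow> p (c *\<^sub>R x) = \<bar>c\<bar> * p x"
  by (auto simp: seminorm_def)

lemma seminorm_minus: "seminorm p \<Longrightarrow> p (- x) = p x"
  using seminorm_scaleR[of p "-1" x] by simp

lemma seminorm_diff: "seminorm p \<Longrightarrow> p (x - y) \<le> p x + p y"
  using seminorm_add[of p x "- y"] by (simp add: seminorm_minus)

lemma seminorm_add_ge: "seminorm p \<Longrightarrow> p x - p y \<le> p (x + y)"
  using seminorm_diff[of p "x + y" y] by simp

lemma seminorm_nonneg: "seminorm p \<Longrightarrow> 0 \<le> p x"
  using seminorm_diff[of p x x] seminorm_scaleR[of p 0 x] by simp

text \<open>A seminorm is convex, and a finite convex function on a finite-dimensional space is
  continuous.\<close>
lemma continuous_on_seminorm: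
  fixes p :: "'a::euclidean_space \<Rightarrow> real"
  assumes p: "seminorm p"
  shows "continuous_on UNIV p"
proof (rule convex_on_continuous)
  show "convex_on UNIV p"
  proof (rule convex_onI)
    fix t x y assume "0 < (t::real)" "t < 1"
    then show "p ((1 - t) *\<^sub>R x + t *\<^sub>R y) \<le> (1 - t) * p x + t * p y"
      using seminorm_add[OF p, of "(1 - t) *\<^sub>R x" "t *\<^sub>R y"] by (simp add: seminorm_scaleR[OF p])
  qed simp
qed simp

lemma splitting_commute: "splitting E F \<Longrightarrow> splitting F E"
proof -
  assume s: "splitting E F"
  show "splitting F E"
    unfolding splitting_def
  proof (intro conjI allI)
    fix x
    have "\<exists>!p. fst p \<in> E \<and> snd p \<in> F \<and> x = fst p + snd p"
      using s by (simp add: splitting_def)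
    then obtain p where ab: "fst p \<in> E" "snd p \<in> F" "x = fst p + snd p"
      and u: "\<And>q. fst q \<in> E \<and> snd q \<in> F \<and> x = fst q + snd q \<Longrightarrow> q = p"
      by (elim ex1E) blast
    show "\<exists>!p. fst p \<in> F \<and> snd p \<in> E \<and> x = fst p + snd p"
    proof (rule ex1I[of _ "prod.swap p"])
      fix q assume "fst q \<in> F \<and> snd q \<in> E \<and> x = fst q + snd q"
      then have "prod.swap q = p"
        by (intro u) (simp add: add.commute)
      then show "q = prod.swap p" by auto
    qed (use ab in \<open>simp add: add.commute\<close>)
  qed (use s in \<open>auto simp: splitting_def\<close>)
qed

lemma component_unique:
  assumes s: "splitting E F" and ab: "a \<in> E" "b \<in> F"
  shows "component E F (a + b) = a"
  unfolding component_def
proof (rule the_equality)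
  fix y assume "y \<in> E \<and> a + b - y \<in> F"
  moreover have "\<exists>!p. fst p \<in> E \<and> snd p \<in> F \<and> a + b = fst p + snd p"
    using s by (simp add: splitting_def)
  then obtain p where u: "\<And>q. fst q \<in> E \<and> snd q \<in> F \<and> a + b = fst q + snd q \<Longrightarrow> q = p"
    by (elim ex1E) blast
  ultimately have "(y, a + b - y) = p" by (intro u) simp
  moreover have "(a, b) = p" using ab by (intro u) simp
  ultimately show "y = a" by auto
qed (use ab in simp)

lemma splitting_decompose:
  assumes "splitting E F"
  obtains a b where "a \<in> E" "b \<in> F" "x = a + b"
  using assms unfolding splitting_def by blast

text \<open>Composing with the projection turns a norm that is meaningful only on one summand into a
  seminorm on the whole space. The unstable cone can then be written as a comparison of two
  seminorms, and both are automatically continuous.\<close>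
lemma seminorm_component:
  assumes s: "splitting E F" and N: "norm_on E N"
  shows "seminorm (\<lambda>x. N (component E F x))"
proof -
  have sub: "subspace E" "subspace F" using s by (auto simp: splitting_def)
  have "N (component E F (x + y)) \<le> N (component E F x) + N (component E F y)" for x y
  proof -
    obtain a b where x: "a \<in> E" "b \<in> F" "x = a + b" using splitting_decompose[OF s] .
    obtain c d where y: "c \<in> E" "d \<in> F" "y = c + d" using splitting_decompose[OF s] .
    have "component E F (x + y) = a + c"
      using component_unique[OF s, of "a + c" "b + d"] x y sub
      by (simp add: subspace_add algebra_simps)
    then show ?thesis
      using N x y component_unique[OF s] by (simp add: norm_on_def)
  qed
  moreover have "N (component E F (c *\<^sub>R x)) = \<bar>c\<bar> * N (component E F x)" for c x
  proof -
    obtain a b where x: "a \<in> E" "b \<in> F" "x = a + b" using splitting_decompose[OF s] .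
    have "component E F (c *\<^sub>R x) = c *\<^sub>R a"
      using component_unique[OF s, of "c *\<^sub>R a" "c *\<^sub>R b"] x sub
      by (simp add: subspace_scale algebra_simps)
    then show ?thesis
      using N x component_unique[OF s] by (simp add: norm_on_def)
  qed
  ultimately show ?thesis by (simp add: seminorm_def)
qed

section \<open>Sets satisfying a cone condition are null\<close>

text \<open>The translates of the closure along \<open>e\<close> are disjoint because a common point of two of
  them would give two points of the closure differing by a nonzero multiple of \<open>e\<close>, which lies in
  the forbidden cone. The closure is used because \<open>W\<close> itself may fail to be measurable.\<close>
lemma null_of_cone_bound:
  fixes W :: "'a::euclidean_space set"
  assumes W: "bounded W" and p: "seminorm p" and q: "seminorm q"
    and cone: "\<And>x y. x \<in> W \<Longrightarrow> y \<in> W \<Longrightarrow> p (x - y) \<le> q (x - y)"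
    and e: "q e < p e"
  shows "W \<in> null_sets lebesgue"
proof -
  define C where "C = closure W"
  have C: "compact C" using W by (simp add: C_def compact_closure)
  have cont: "continuous_on UNIV (\<lambda>z. p (fst z - snd z))" "continuous_on UNIV (\<lambda>z. q (fst z - snd z))"
    by (intro continuous_on_compose2[OF continuous_on_seminorm[OF p]] continuous_intros; simp)
       (intro continuous_on_compose2[OF continuous_on_seminorm[OF q]] continuous_intros; simp)
  \<comment> \<open>The cone condition is closed, so it passes from \<open>W\<close> to its closure.\<close>
  have "closure (W \<times> W) \<subseteq> {z. p (fst z - snd z) \<le> q (fst z - snd z)}"
    using cone by (intro closure_minimal closed_Collect_le cont) auto
  then have coneC: "p (x - y) \<le> q (x - y)" if "x \<in> C" "y \<in> C" for x y
    using that by (auto simp: C_def closure_Times)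
  define A where "A n = (+) (inverse (real (Suc n)) *\<^sub>R e) ` C" for n
  have disj: "disjoint_family A"
    unfolding disjoint_family_on_def
  proof (intro ballI impI, rule ccontr)
    fix m n :: nat assume "m \<noteq> n" "A m \<inter> A n \<noteq> {}"
    then obtain x y where xy: "x \<in> C" "y \<in> C"
      and eq: "inverse (real (Suc m)) *\<^sub>R e + x = inverse (real (Suc n)) *\<^sub>R e + y"
      by (auto simp: A_def)
    define t where "t = inverse (real (Suc n)) - inverse (real (Suc m))"
    have t: "t \<noteq> 0" using \<open>m \<noteq> n\<close> by (simp add: t_def)
    have "x - y = t *\<^sub>R e" using eq by (simp add: t_def algebra_simps)
    with coneC[OF xy] have "\<bar>t\<bar> * p e \<le> \<bar>t\<bar> * q e"
      by (simp add: seminorm_scaleR[OF p] seminorm_scaleR[OF q])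
    with t e show False by simp
  qed
  have cA: "compact (A n)" for n unfolding A_def using C by (rule compact_translation)
  have lA: "A n \<in> lmeasurable" for n using cA by (rule lmeasurable_compact)
  obtain B where B: "\<And>x. x \<in> C \<Longrightarrow> norm x \<le> B"
    using compact_imp_bounded[OF C] by (auto simp: bounded_iff)
  have "(\<Union>n. A n) \<subseteq> cball 0 (norm e + B)"
  proof clarify
    fix n x assume "x \<in> A n"
    then obtain c where c: "c \<in> C" "x = inverse (real (Suc n)) *\<^sub>R e + c" by (auto simp: A_def)
    have "norm x \<le> norm (inverse (real (Suc n)) *\<^sub>R e) + norm c"
      unfolding c(2) by (rule norm_triangle_ineq)
    also have "norm (inverse (real (Suc n)) *\<^sub>R e) \<le> 1 * norm e"
      unfolding norm_scaleR by (intro mult_right_mono) (auto simp: field_simps)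
    finally show "x \<in> cball 0 (norm e + B)" using B[OF c(1)] by simp
  qed
  then have "(\<Union>n. A n) \<in> lmeasurable"
    using lA by (intro bounded_set_imp_lmeasurable)
      (auto intro: bounded_subset[OF bounded_cball] simp: fmeasurableD)
  then have "emeasure lebesgue (\<Union>n. A n) \<noteq> \<infinity>"
    using fmeasurableD2 by (metis infinity_ennreal_def)
  then have "(\<lambda>n. measure lebesgue (A n)) sums measure lebesgue (\<Union>n. A n)"
    using fmeasurableD[OF lA] by (intro measure_UNION[OF _ disj]) blast+
  moreover have "measure lebesgue (A n) = measure lebesgue C" for n
    unfolding A_def by (rule measure_translation)
  ultimately have "measure lebesgue C = 0"
    by (simp add: sums_iff summable_const_iff)
  then have "C \<in> null_sets lebesgue"
    using lmeasurable_compact[OF C]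
    by (simp add: negligible_iff_measure0 flip: negligible_iff_null_sets)
  then show ?thesis
    using closure_subset[of W] by (auto simp: C_def intro: completion.complete2)
qed

section \<open>Expansion inside the unstable cone\<close>

text \<open>Since \<open>\<epsilon> < (\<mu> - l) / 4\<close>, the two bounds also show that the image of the difference lies in
  the cone again, so that the estimate can be iterated.\<close>
lemma PH_cone_step:
  assumes PH: "PH \<mu> l \<epsilon> U Ecs Eu Ncs Nu g T" and xy: "x \<in> U" "y \<in> U"
  defines "p \<equiv> \<lambda>x. Nu (component Eu Ecs x)" and "q \<equiv> \<lambda>x. Ncs (component Ecs Eu x)"
  assumes cone: "q (x - y) \<le> p (x - y)" and pos: "0 < p (x - y)"
  shows "(\<mu> - \<epsilon>) * p (x - y) \<le> p (g x - g y)" "q (g x - g y) \<le> (l + \<epsilon>) * p (x - y)"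
proof -
  have s: "splitting Ecs Eu" and N: "norm_on Ecs Ncs" "norm_on Eu Nu" and lin: "linear T"
    and eps: "0 < \<epsilon>" and l: "1 \<le> l" and inv: "T ` Ecs \<subseteq> Ecs" "T ` Eu \<subseteq> Eu"
    and Tcs: "\<And>y. y \<in> Ecs \<Longrightarrow> max_norm Ecs Eu Ncs Nu (T y) \<le> l * max_norm Ecs Eu Ncs Nu y"
    and Tu: "\<And>z. z \<in> Eu \<Longrightarrow> max_norm Ecs Eu Ncs Nu (T z) \<ge> \<mu> * max_norm Ecs Eu Ncs Nu z"
    and Lip: "Lip (max_norm Ecs Eu Ncs Nu) (\<lambda>x. g x - T x) U \<le> ennreal \<epsilon>"
    using PH by (auto simp: PH_def)
  note s' = splitting_commute[OF s]
  have p: "seminorm p" and q: "seminorm q"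
    unfolding p_def q_def using seminorm_component s s' N by blast+
  have sub: "0 \<in> Ecs" "0 \<in> Eu" using s by (auto simp: splitting_def subspace_0)
  have N0: "Ncs 0 = 0" "Nu 0 = 0" using N sub by (auto simp: norm_on_def)
  have Nge: "\<And>y. y \<in> Ecs \<Longrightarrow> 0 \<le> Ncs y" "\<And>z. z \<in> Eu \<Longrightarrow> 0 \<le> Nu z"
    using N by (auto simp: norm_on_def)
  have pq: "q (a + b) = Ncs a" "p (a + b) = Nu b" if "a \<in> Ecs" "b \<in> Eu" for a b
    using that component_unique[OF s, of a b] component_unique[OF s', of b a]
    by (simp_all add: p_def q_def add.commute)
  have mcs: "max_norm Ecs Eu Ncs Nu a = Ncs a" if "a \<in> Ecs" for a
    using pq[of a 0] that sub N0 Nge by (simp add: max_norm_def p_def q_def)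
  have mu: "max_norm Ecs Eu Ncs Nu b = Nu b" if "b \<in> Eu" for b
    using pq[of 0 b] that sub N0 Nge by (simp add: max_norm_def p_def q_def)
  obtain a b where ab: "a \<in> Ecs" "b \<in> Eu" "x - y = a + b" using splitting_decompose[OF s] .
  have Tab: "T a \<in> Ecs" "T b \<in> Eu" using ab inv by auto
  have Tsum: "T (x - y) = T a + T b" unfolding ab(3) using lin by (rule linear_add)
  have Tp: "\<mu> * p (x - y) \<le> p (T (x - y))"
    unfolding Tsum pq(2)[OF Tab] using Tu[OF ab(2)] ab(1,2) Tab by (simp add: ab(3) pq mu)
  have Tq: "q (T (x - y)) \<le> l * q (x - y)"
    unfolding Tsum pq(1)[OF Tab] using Tcs[OF ab(1)] ab(1,2) Tab by (simp add: ab(3) pq mcs)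
  define h where "h = (g x - T x) - (g y - T y)"
  have ne: "x \<noteq> y" using pos p by (auto simp: seminorm_def dest: spec[of _ 0])
  have mxy: "max_norm Ecs Eu Ncs Nu (x - y) = p (x - y)"
    using cone by (simp add: max_norm_def p_def q_def)
  have "ennreal (max_norm Ecs Eu Ncs Nu h / max_norm Ecs Eu Ncs Nu (x - y)) \<le>
      Lip (max_norm Ecs Eu Ncs Nu) (\<lambda>x. g x - T x) U"
    unfolding Lip_def h_def using xy ne by (intro SUP_upper2[of "(x, y)"]) auto
  with Lip have "ennreal (max_norm Ecs Eu Ncs Nu h / p (x - y)) \<le> ennreal \<epsilon>"
    unfolding mxy by (rule order.trans[rotated])
  then have "max_norm Ecs Eu Ncs Nu h \<le> \<epsilon> * p (x - y)"
    using eps pos by (simp add: ennreal_le_iff pos_divide_le_eq)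
  then have h: "p h \<le> \<epsilon> * p (x - y)" "q h \<le> \<epsilon> * p (x - y)"
    by (simp_all add: max_norm_def p_def q_def)
  have g: "g x - g y = T (x - y) + h"
    using lin by (simp add: h_def linear_diff)
  show "(\<mu> - \<epsilon>) * p (x - y) \<le> p (g x - g y)"
    unfolding g using seminorm_add_ge[OF p, of "T (x - y)" h] Tp h by (simp add: algebra_simps)
  have "l * q (x - y) \<le> l * p (x - y)" using cone l by simp
  then show "q (g x - g y) \<le> (l + \<epsilon>) * p (x - y)"
    unfolding g using seminorm_add[OF q, of "T (x - y)" h] Tq h by (simp add: algebra_simps)
qed

lemma unbounded_shifted_sums:
  fixes f :: "nat \<Rightarrow> real"
  assumes lim: "filterlim (\<lambda>n. \<Sum>k=K..n. f k) at_top sequentially" and "K \<le> n"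
  obtains m where "B < (\<Sum>i<m. f (n + i))"
proof -
  have "eventually (\<lambda>N. B + (\<Sum>k=K..<n. f k) < (\<Sum>k=K..N. f k)) sequentially"
    using lim by (simp add: filterlim_at_top_dense)
  then obtain N where N: "n \<le> N" "B + (\<Sum>k=K..<n. f k) < (\<Sum>k=K..N. f k)"
    unfolding eventually_sequentially by (meson max.cobounded1 max.cobounded2)
  have "(\<Sum>k=K..N. f k) = (\<Sum>k=K..<n. f k) + (\<Sum>k=n..<Suc N. f k)"
    using N(1) \<open>K \<le> n\<close> by (simp add: sum.atLeastLessThan_concat atLeastLessThanSuc_atLeastAtMost[symmetric]
        del: sum.op_ivl_Suc)
  also have "(\<Sum>k=n..<Suc N. f k) = (\<Sum>i<Suc N - n. f (n + i))"
    using N(1) by (simp add: sum.atLeastLessThan_shift_0[of f n] atLeast0LessThan add.commute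
        del: sum.op_ivl_Suc)
  finally show thesis using N(2) by (intro that[of "Suc N - n"]) simp
qed

section \<open>Points that stay near an unstable fixed point\<close>

text \<open>Intersecting the dynamical neighborhood with a ball makes the set of points that never leave
  it bounded, as \<open>null_of_cone_bound\<close> requires. The neighborhood does not depend on the starting
  time \<open>n\<close>, which is what lets a countable subcover serve all times.\<close>
lemma NPH_null_neighborhood:
  fixes g :: "nat \<Rightarrow> 'a::euclidean_space \<Rightarrow> 'a"
  assumes "NPH_unstable_fixed_point g s"
  obtains V K where "open V" "s \<in> V"
    "\<And>n. n \<ge> K \<Longrightarrow> {x. \<forall>m. trajectory (\<lambda>k. g (n + k)) x m \<in> V} \<in> null_sets lebesgue"
proof -
  from assms obtain Ecs Eu Ncs Nu T r K \<mu> l \<epsilon> where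
    s: "splitting Ecs Eu" and dim: "dim Eu \<ge> 1" and N: "norm_on Ecs Ncs" "norm_on Eu Nu"
    and "\<forall>k. linear (T k)" "r > 0"
    and pos': "\<forall>k\<ge>K. \<mu> k > 0 \<and> l k > 0 \<and> \<epsilon> k > 0"
    and PH': "\<forall>k\<ge>K. PH (\<mu> k) (l k) (\<epsilon> k / 4) {x. max_norm Ecs Eu Ncs Nu x < r} Ecs Eu Ncs Nu
                  (\<lambda>x. g k (x + s) - s) (T k)"
    and gap': "\<forall>k\<ge>K. \<epsilon> k < (\<mu> k - l k) / 4"
    and div: "filterlim (\<lambda>n. \<Sum>k=K..n. \<epsilon> k / (\<mu> k - 2 * \<epsilon> k)) at_top sequentially"
    unfolding NPH_unstable_fixed_point_def by (elim conjE exE) (rule that, assumption+)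
  have pos: "\<epsilon> k > 0" and gap: "l k + 4 * \<epsilon> k < \<mu> k" if "k \<ge> K" for k
    using pos' gap' that by (auto simp: field_simps)
  note PH = PH'[rule_format]
  define U where "U = {x. max_norm Ecs Eu Ncs Nu x < r}"
  define p where "p = (\<lambda>x. Nu (component Eu Ecs x))"
  define q where "q = (\<lambda>x. Ncs (component Ecs Eu x))"
  note s' = splitting_commute[OF s]
  have p: "seminorm p" and q: "seminorm q"
    unfolding p_def q_def using seminorm_component s s' N by blast+
  have U: "open U" "0 \<in> U" using PH[of K] by (auto simp: PH_def U_def)
  define V where "V = (+) s ` (U \<inter> ball 0 1)"
  have l: "1 \<le> l k" if "k \<ge> K" for k using PH[OF that] by (simp add: PH_def)

  have cone: "p (x - y) \<le> q (x - y)"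
    if n: "n \<ge> K" and x: "\<forall>m. trajectory (\<lambda>k. g (n + k)) x m \<in> V"
      and y: "\<forall>m. trajectory (\<lambda>k. g (n + k)) y m \<in> V" for n x y
  proof (rule ccontr)
    assume "\<not> p (x - y) \<le> q (x - y)"
    then have c0: "q (x - y) < p (x - y)" by simp
    then have p0: "0 < p (x - y)" using seminorm_nonneg[OF q, of "x - y"] by simp
    define D where "D m = trajectory (\<lambda>k. g (n + k)) x m - trajectory (\<lambda>k. g (n + k)) y m" for m
    have VU: "trajectory (\<lambda>k. g (n + k)) x m - s \<in> U" "trajectory (\<lambda>k. g (n + k)) y m - s \<in> U" for m
      using x[rule_format, of m] y[rule_format, of m] by (auto simp: V_def)
    \<comment> \<open>Each step adds at least \<open>3 * \<epsilon>\<close> times the initial size of the unstable component. This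
      linear lower bound for the product of the expansion factors already diverges.\<close>
    have grow: "q (D m) \<le> p (D m) \<and> p (x - y) + 3 * p (x - y) * (\<Sum>i<m. \<epsilon> (n + i)) \<le> p (D m)" for m
    proof (induction m)
      case 0
      show ?case using c0 by (simp add: D_def)
    next
      case (Suc m)
      have k: "n + m \<ge> K" using n by simp
      have "0 \<le> (\<Sum>i<m. \<epsilon> (n + i))" using pos n by (intro sum_nonneg) (simp add: less_imp_le)
      then have "0 \<le> 3 * p (x - y) * (\<Sum>i<m. \<epsilon> (n + i))" using p0 by simp
      with Suc have pD: "p (x - y) \<le> p (D m)" by linarith
      have "q (D m) \<le> p (D m)" "0 < p (D m)" using Suc p0 pD by auto
      then have step: "(\<mu> (n + m) - \<epsilon> (n + m) / 4) * p (D m) \<le> p (D (Suc m))"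
        "q (D (Suc m)) \<le> (l (n + m) + \<epsilon> (n + m) / 4) * p (D m)"
        using PH_cone_step[OF PH[OF k], folded U_def, OF VU(1)[of m] VU(2)[of m]]
        by (simp_all add: D_def p_def q_def)
      have "(l (n + m) + \<epsilon> (n + m) / 4) * p (D m) \<le> (\<mu> (n + m) - \<epsilon> (n + m) / 4) * p (D m)"
        using gap[OF k] pos[OF k] \<open>0 < p (D m)\<close> by (intro mult_right_mono) auto
      moreover have "(1 + 3 * \<epsilon> (n + m)) * p (D m) \<le> (\<mu> (n + m) - \<epsilon> (n + m) / 4) * p (D m)"
        using gap[OF k] pos[OF k] l[OF k] \<open>0 < p (D m)\<close> by (intro mult_right_mono) auto
      moreover have "\<epsilon> (n + m) * p (x - y) \<le> \<epsilon> (n + m) * p (D m)"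
        using pos[OF k] pD by simp
      ultimately show ?case using step Suc by (simp add: algebra_simps)
    qed
    have bound: "p (D m) \<le> 2 * r" for m
      using seminorm_diff[OF p, of "trajectory (\<lambda>k. g (n + k)) x m - s" "trajectory (\<lambda>k. g (n + k)) y m - s"]
        VU[of m] by (simp add: U_def max_norm_def D_def p_def)
    obtain m where m: "2 * r / (3 * p (x - y)) <
        (\<Sum>i<m. \<epsilon> (n + i) / (\<mu> (n + i) - 2 * \<epsilon> (n + i)))"
      using unbounded_shifted_sums[OF div n] .
    also have "\<dots> \<le> (\<Sum>i<m. \<epsilon> (n + i))"
    proof (rule sum_mono)
      fix i
      have k: "n + i \<ge> K" using n by simp
      have "1 \<le> \<mu> (n + i) - 2 * \<epsilon> (n + i)" using gap[OF k] pos[OF k] l[OF k] by linarith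
      then show "\<epsilon> (n + i) / (\<mu> (n + i) - 2 * \<epsilon> (n + i)) \<le> \<epsilon> (n + i)"
        using pos[OF k] by (simp add: divide_le_eq)
    qed
    finally have "2 * r < 3 * p (x - y) * (\<Sum>i<m. \<epsilon> (n + i))"
      using p0 by (simp add: field_simps)
    then show False using grow[of m] bound[of m] p0 by linarith
  qed

  obtain e where e: "e \<in> Eu" "e \<noteq> 0"
    using dim dim_eq_0[of Eu] by fastforce
  have "0 \<in> Ecs" using s by (simp add: splitting_def subspace_0)
  then have "component Eu Ecs e = e" "component Ecs Eu e = 0"
    using component_unique[OF s' e(1), of 0] component_unique[OF s, of 0 e] e by auto
  then have pe: "q e < p e"
    using N e \<open>0 \<in> Ecs\<close> by (auto simp: p_def q_def norm_on_def less_le)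

  show thesis
  proof
    show "open V" unfolding V_def using U by (intro open_translation) auto
    show "s \<in> V" using U by (auto simp: V_def image_iff intro: bexI[of _ 0])
    fix n assume n: "n \<ge> K"
    have "{x. \<forall>m. trajectory (\<lambda>k. g (n + k)) x m \<in> V} \<subseteq> V"
      by (auto dest: spec[of _ 0])
    moreover have "bounded V"
      unfolding V_def by (intro bounded_translation bounded_Int disjI2 bounded_ball)
    ultimately show "{x. \<forall>m. trajectory (\<lambda>k. g (n + k)) x m \<in> V} \<in> null_sets lebesgue"
      using cone[OF n] by (intro null_of_cone_bound[OF _ p q _ pe]) (auto intro: bounded_subset)
  qed
qed

section \<open>From local to global\<close>

lemma trajectory_add:
  "trajectory g x (n + m) = trajectory (\<lambda>k. g (n + k)) (trajectory g x n) m"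
  by (induction m) auto

lemma null_sets_trajectory_vimage:
  assumes "\<And>k. luzin_N_inv (g k)" "E \<in> null_sets lebesgue"
  shows "{x. trajectory g x n \<in> E} \<in> null_sets lebesgue"
  using assms(2)
proof (induction n arbitrary: E)
  case (Suc n)
  from Suc.prems assms(1)[of n] have "g n -` E \<in> null_sets lebesgue"
    by (simp add: luzin_N_inv_def)
  from Suc.IH[OF this] show ?case by simp
qed simp

theorem theorem2p14:
  fixes g :: "nat \<Rightarrow> real ^ 'd \<Rightarrow> real ^ 'd"
  assumes "\<And>k. luzin_N_inv (g k)"
  shows "avoids g {x. NPH_unstable_fixed_point g x}"
proof -
  define W where "W V n = {x. \<forall>m. trajectory (\<lambda>k. g (n + k)) x m \<in> V}" for V n
  define F where "F = {V. open V \<and> (\<exists>K. \<forall>n\<ge>K. W V n \<in> null_sets lebesgue)}"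
  obtain F' where F': "F' \<subseteq> F" "countable F'" "\<Union>F' = \<Union>F"
    using Lindelof[of F] by (auto simp: F_def)
  have "\<forall>V\<in>F. \<exists>K. \<forall>n\<ge>K. W V n \<in> null_sets lebesgue" by (simp add: F_def)
  then obtain K where K: "\<And>V n. V \<in> F \<Longrightarrow> n \<ge> K V \<Longrightarrow> W V n \<in> null_sets lebesgue"
    by metis
  define Z where "Z = (\<Union>V\<in>F'. \<Union>n. {x. trajectory g x (K V + n) \<in> W V (K V + n)})"
  have "Z \<in> null_sets lebesgue"
    unfolding Z_def using F' K assms
    by (intro null_sets_UN' null_sets_trajectory_vimage) auto
  moreover have "{x. \<exists>s\<in>{x. NPH_unstable_fixed_point g x}. trajectory g x \<longlonglongrightarrow> s} \<subseteq> Z"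
  proof clarify
    fix x s assume NPH: "NPH_unstable_fixed_point g s" and lim: "trajectory g x \<longlonglongrightarrow> s"
    have "s \<in> \<Union>F"
    proof (rule NPH_null_neighborhood[OF NPH])
      fix V K assume "open V" "s \<in> V"
        "\<And>n. n \<ge> K \<Longrightarrow> {x. \<forall>m. trajectory (\<lambda>k. g (n + k)) x m \<in> V} \<in> null_sets lebesgue"
      then have "V \<in> F" unfolding F_def W_def by auto
      with \<open>s \<in> V\<close> show ?thesis by blast
    qed
    then obtain V where V: "V \<in> F'" "s \<in> V" unfolding F'(3)[symmetric] by blast
    then have "open V" using F' by (auto simp: F_def)
    with lim V obtain n where n: "\<And>m. m \<ge> n \<Longrightarrow> trajectory g x m \<in> V"
      by (auto simp: tendsto_def eventually_sequentially)
    then have "trajectory g x (K V + n) \<in> W V (K V + n)"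
      unfolding W_def mem_Collect_eq by (subst trajectory_add[symmetric]) simp
    with V show "x \<in> Z" by (auto simp: Z_def)
  qed
  ultimately show ?thesis
    unfolding avoids_def by (rule completion.complete2[rotated])
qed

end
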